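(* Let $D\subset\mathbb{R}$, $\phi_0\in\mathbb{R}\setminus D$, let $\pi$ be a probability distribution for $(\phi,\sigma)$ on $\mathbb{R}\times(0,\infty)$ with $\pi(D\times(0,\infty))=1$, and let $\pi_1$ be its $\sigma$-marginal. Consider testing problems with $N$ hypotheses in which it is fixed (non-random) which of the $H_0^j$ are true and which are false; the pairs $(\phi_j,\sigma_j)$, $j=1,\dots,N$, are independent; $(\phi_j,\sigma_j)\sim\pi$ for each $j$ with $H_0^j$ false; and $\phi_j=\phi_0$, $\sigma_j\sim\pi_1$ for each $j$ with $H_0^j$ true. Let $N_1$ be the number of $j$ with $H_0^j$ false. For measurable $C\subset\mathbb{R}^T$ let $$\mathrm{ETP}=\sum_{\{j\mid H_0^j\text{ is false}\}}P_{\phi_j,\sigma_j}({\bf y}_j\in C),\qquad \mathrm{EFP}=\sum_{\{j\mid H_0^j\text{ is true}\}}P_{\phi_0,\sigma_j}({\bf y}_j\in C),$$ $$\mathrm{BETP}=\int P_{\phi,\sigma}({\bf y}\in C)\,d\pi(\phi,\sigma)=\int_{{\bf y}\in C}\int f({\bf y}\mid\phi,\sigma)\,d\pi(\phi,\sigma)\,d{\bf y},$$ $$\mathrm{BEFP}=\int P_{\phi_0,\sigma}({\bf y}\in C)\,d\pi_1(\sigma)=\int_{{\bf y}\in C}\int f({\bf y}\mid\phi_0,\sigma)\,d\pi_1(\sigma)\,d{\bf y}.$$ (1) For every fixed measurable $C$, along any sequence of such problems with $N_1\to\infty$ and $N-N_1\to\infty$, $$\frac{\mathrm{ETP}}{N_1}-\mathrm{BETP}\longrightarrow0\quad\text{and}\quad\frac{\mathrm{EFP}}{N-N_1}-\mathrm{BEFP}\longrightarrow0\quad\text{in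 probability}.$$ (2) Let $\alpha\in[0,1]$. The MAP test rejects $H_0^j$ if ${\bf y}_j\in C^*$, where $$C^*=\left\{{\bf y}\in\mathbb{R}^T\ \middle|\ \frac{\int_{\phi\in D}f({\bf y}\mid\phi,\sigma)\,d\pi(\phi,\sigma)}{\int f({\bf y}\mid\phi_0,\sigma)\,d\pi_1(\sigma)}>\mathrm{crit}\right\}$$ and the real number $\mathrm{crit}$ is chosen so that $\mathrm{BEFP}=\alpha$ for $C=C^*$; that is, for such $\mathrm{crit}$, $C=C^*$ maximizes $\mathrm{BETP}$ among all measurable $C\subset\mathbb{R}^T$ with $\mathrm{BEFP}\le\alpha$.
   Context: For parameters $\phi\in\mathbb{R}$, $\sigma>0$, $f(\cdot\mid\phi,\sigma)$ is a probability density on $\mathbb{R}^T$, jointly measurable in its arguments, and $P_{\phi,\sigma}({\bf y}\in C)=\int_{C}f({\bf y}\mid\phi,\sigma)\,d{\bf y}$. The $j$-th observation ${\bf y}_j$ has density $f(\cdot\mid\phi_j,\sigma_j)$ given its parameters. The hypotheses are $H_0^j:\phi_j=\phi_0$ versus $H_1^j:\phi_j\in D$, $j=1,\dots,N$; procedures considered reject $H_0^j$ if and only if ${\bf y}_j\in C$ with $C$ not depending on $j$. ETP and EFP (expected numbers of true and false positives for given parameters) are random through the $(\phi_j,\sigma_j)$. The MAP (maximum average power) test at level $\alpha$ is the test maximizing $\mathrm{BETP}$ among all tests with $\mathrm{BEFP}\le\alpha$. Convention for ratios: $a/0=+\infty$ for $a>0$ and $0/0=0$. *)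

theory Defs
  imports "HOL-Probability.Probability"
begin

text \<open>
  The parameter space \<open>\<real> \<times> (0,\<infinity>)\<close>, with its Borel sets. Observations live in \<open>real ^ 't\<close>,
  so \<open>T\<close> is \<open>CARD('t)\<close>; ``measurable'' always means Borel measurable.
\<close>

definition sigma_space :: "real measure" where
  "sigma_space = restrict_space borel {0<..}"

definition param_space :: "(real \<times> real) measure" where
  "param_space = borel \<Otimes>\<^sub>M sigma_space"

text \<open>The values \<open>f \<phi> \<sigma>\<close> with \<open>\<sigma> \<le> 0\<close> are unconstrained and never used.\<close>

definition density_family :: "(real \<Rightarrow> real \<Rightarrow> real ^ 't \<Rightarrow> real) \<Rightarrow> bool" where
  "density_family f \<longleftrightarrow>
     (\<lambda>((\<phi>, \<sigma>), y). f \<phi> \<sigma> y) \<in> borel_measurable (param_space \<Otimes>\<^sub>M borel) \<and>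
     (\<forall>\<phi> \<sigma>. 0 < \<sigma> \<longrightarrow>
        (\<forall>y. 0 \<le> f \<phi> \<sigma> y) \<and> (\<integral>\<^sup>+ y. ennreal (f \<phi> \<sigma> y) \<partial>lborel) = 1)"

definition rej_prob :: "(real \<Rightarrow> real \<Rightarrow> real ^ 't \<Rightarrow> real) \<Rightarrow> real \<Rightarrow> real \<Rightarrow> (real ^ 't) set \<Rightarrow> real" where
  "rej_prob f \<phi> \<sigma> C = (LINT y:C|lborel. f \<phi> \<sigma> y)"

definition sigma_marginal :: "(real \<times> real) measure \<Rightarrow> real measure" where
  "sigma_marginal \<pi> = distr \<pi> sigma_space snd"

definition BETP :: "(real \<Rightarrow> real \<Rightarrow> real ^ 't \<Rightarrow> real) \<Rightarrow> (real \<times> real) measure \<Rightarrow> (real ^ 't) set \<Rightarrow> real" where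
  "BETP f \<pi> C = (LINT (\<phi>, \<sigma>)|\<pi>. rej_prob f \<phi> \<sigma> C)"

definition BEFP ::
  "(real \<Rightarrow> real \<Rightarrow> real ^ 't \<Rightarrow> real) \<Rightarrow> (real \<times> real) measure \<Rightarrow> real \<Rightarrow> (real ^ 't) set \<Rightarrow> real" where
  "BEFP f \<pi> \<phi>\<^sub>0 C = (LINT \<sigma>|sigma_marginal \<pi>. rej_prob f \<phi>\<^sub>0 \<sigma> C)"

text \<open>
  A problem with hypotheses \<open>1, \<dots>, N\<close>, of which exactly those in the fixed set \<open>F\<close> are false;
  \<open>\<theta> j = (\<phi>\<^sub>j, \<sigma>\<^sub>j)\<close> is a random variable on the probability space \<open>M\<close>.
\<close>

definition testing_problem ::
  "(real \<times> real) measure \<Rightarrow> real \<Rightarrow> 'a measure \<Rightarrow> nat \<Rightarrow> nat set \<Rightarrow> (nat \<Rightarrow> 'a \<Rightarrow> real \<times> real) \<Rightarrow> bool" where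
  "testing_problem \<pi> \<phi>\<^sub>0 M N F \<theta> \<longleftrightarrow>
     prob_space M \<and> F \<subseteq> {1..N} \<and>
     prob_space.indep_vars M (\<lambda>_. param_space) \<theta> {1..N} \<and>
     (\<forall>j\<in>F. distr M param_space (\<theta> j) = \<pi>) \<and>
     (\<forall>j\<in>{1..N} - F. (AE \<omega> in M. fst (\<theta> j \<omega>) = \<phi>\<^sub>0) \<and>
        distr M sigma_space (\<lambda>\<omega>. snd (\<theta> j \<omega>)) = sigma_marginal \<pi>)"

definition ETP ::
  "(real \<Rightarrow> real \<Rightarrow> real ^ 't \<Rightarrow> real) \<Rightarrow> nat set \<Rightarrow> (nat \<Rightarrow> 'a \<Rightarrow> real \<times> real) \<Rightarrow> (real ^ 't) set \<Rightarrow> 'a \<Rightarrow> real" where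
  "ETP f F \<theta> C \<omega> = (\<Sum>j\<in>F. rej_prob f (fst (\<theta> j \<omega>)) (snd (\<theta> j \<omega>)) C)"

definition EFP ::
  "(real \<Rightarrow> real \<Rightarrow> real ^ 't \<Rightarrow> real) \<Rightarrow> real \<Rightarrow> nat \<Rightarrow> nat set \<Rightarrow> (nat \<Rightarrow> 'a \<Rightarrow> real \<times> real) \<Rightarrow>
     (real ^ 't) set \<Rightarrow> 'a \<Rightarrow> real" where
  "EFP f \<phi>\<^sub>0 N F \<theta> C \<omega> = (\<Sum>j\<in>{1..N} - F. rej_prob f \<phi>\<^sub>0 (snd (\<theta> j \<omega>)) C)"

text \<open>The probability space may vary along the sequence.\<close>

definition tendsto_zero_in_prob :: "(nat \<Rightarrow> 'a measure) \<Rightarrow> (nat \<Rightarrow> 'a \<Rightarrow> real) \<Rightarrow> bool" where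
  "tendsto_zero_in_prob M X \<longleftrightarrow>
     (\<forall>n. X n \<in> borel_measurable (M n)) \<and>
     (\<forall>\<epsilon>>0. (\<lambda>n. measure (M n) {\<omega> \<in> space (M n). \<bar>X n \<omega>\<bar> > \<epsilon>}) \<longlonglongrightarrow> 0)"

definition MAP_region ::
  "(real \<Rightarrow> real \<Rightarrow> real ^ 't \<Rightarrow> real) \<Rightarrow> (real \<times> real) measure \<Rightarrow> real \<Rightarrow> real \<Rightarrow> (real ^ 't) set \<Rightarrow> bool" where
  "MAP_region f \<pi> \<phi>\<^sub>0 \<alpha> C \<longleftrightarrow>
     C \<in> sets borel \<and> BEFP f \<pi> \<phi>\<^sub>0 C \<le> \<alpha> \<and>
     (\<forall>C'\<in>sets borel. BEFP f \<pi> \<phi>\<^sub>0 C' \<le> \<alpha> \<longrightarrow> BETP f \<pi> C' \<le> BETP f \<pi> C)"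

text \<open>
  Division on \<open>ennreal\<close> satisfies \<open>a / 0 = \<infinity>\<close> for \<open>a > 0\<close> and \<open>0 / 0 = 0\<close>. The comparison with
  the threshold takes place in \<open>ereal\<close> because the threshold may be negative.
\<close>

definition lik_ratio ::
  "(real \<Rightarrow> real \<Rightarrow> real ^ 't \<Rightarrow> real) \<Rightarrow> real set \<Rightarrow> (real \<times> real) measure \<Rightarrow> real \<Rightarrow> real ^ 't \<Rightarrow> ennreal" where
  "lik_ratio f D \<pi> \<phi>\<^sub>0 y =
     (\<integral>\<^sup>+ (\<phi>, \<sigma>) \<in> D \<times> {0<..}. ennreal (f \<phi> \<sigma> y) \<partial>\<pi>) /
     (\<integral>\<^sup>+ \<sigma>. ennreal (f \<phi>\<^sub>0 \<sigma> y) \<partial>sigma_marginal \<pi>)"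

definition C_star ::
  "(real \<Rightarrow> real \<Rightarrow> real ^ 't \<Rightarrow> real) \<Rightarrow> real set \<Rightarrow> (real \<times> real) measure \<Rightarrow> real \<Rightarrow> real \<Rightarrow> (real ^ 't) set" where
  "C_star f D \<pi> \<phi>\<^sub>0 crit = {y. enn2ereal (lik_ratio f D \<pi> \<phi>\<^sub>0 y) > ereal crit}"

end

theory Submission
  imports Defs "HOL-Real_Asymp.Real_Asymp"
begin

text \<open>
  Given the parameters, each rejection probability is a function of \<open>(\<phi>\<^sub>j, \<sigma>\<^sub>j)\<close> with values in
  \<open>[0, 1]\<close>, so ETP and EFP are sums of independent, identically distributed bounded variables with
  means BETP and BEFP, and Hoeffding's inequality gives (1). By Fubini, BETP and BEFP are the
  probabilities of \<open>C\<close> under the two mixture densities of \<open>y\<close>, so (2) is the Neyman--Pearson lemma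
  for testing one mixture against the other.
\<close>

section \<open>Probability densities and their mixtures\<close>

text \<open>The total mass 1 bounds the integral over \<open>C\<close>, so the integrand is
  integrable and the Bochner integral is a true value rather than the default 0. This links the
  real-valued \<open>rej_prob\<close> to nonnegative integrals, which can be interchanged
  freely.\<close>

lemma set_integral_density:
  fixes h :: "'a \<Rightarrow> real"
  assumes [measurable]: "h \<in> borel_measurable M" "C \<in> sets M"
    and nonneg: "\<And>y. y \<in> space M \<Longrightarrow> 0 \<le> h y"
    and total: "(\<integral>\<^sup>+y. ennreal (h y) \<partial>M) = 1"
  shows "ennreal (LINT y:C|M. h y) = (\<integral>\<^sup>+y\<in>C. ennreal (h y) \<partial>M)" "(LINT y:C|M. h y) \<in> {0..1}"
proof -
  have le: "(\<integral>\<^sup>+y. ennreal (indicator C y * h y) \<partial>M) \<le> 1"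
    unfolding total[symmetric] by (intro nn_integral_mono) (auto simp: indicator_def nonneg)
  have "integrable M (\<lambda>y. indicator C y * h y)"
    by (rule integrableI_nonneg)
       (use le nonneg in \<open>auto simp: indicator_def top_unique less_top[symmetric] intro!: AE_I2\<close>)
  then have "(\<integral>\<^sup>+y. ennreal (indicator C y * h y) \<partial>M) = ennreal (LINT y:C|M. h y)"
    unfolding set_lebesgue_integral_def real_scaleR_def
    by (rule nn_integral_eq_integral) (auto simp: indicator_def nonneg)
  moreover have "(\<integral>\<^sup>+y. ennreal (indicator C y * h y) \<partial>M) = (\<integral>\<^sup>+y\<in>C. ennreal (h y) \<partial>M)"
    by (intro nn_integral_cong) (auto simp: indicator_def)
  moreover have "0 \<le> (LINT y:C|M. h y)"
    unfolding set_lebesgue_integral_def by (intro Bochner_Integration.integral_nonneg) (auto simp: indicator_def nonneg)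
  ultimately show "ennreal (LINT y:C|M. h y) = (\<integral>\<^sup>+y\<in>C. ennreal (h y) \<partial>M)" "(LINT y:C|M. h y) \<in> {0..1}"
    using le by (auto simp: ennreal_le_1)
qed

text \<open>Both real integrals have integrands controlled by 1, so they become nonnegative
  integrals and Tonelli swaps the order. It serves for mixing over (\<phi>, \<sigma>) and for mixing
  over \<sigma> alone.\<close>

lemma mixture_probability:
  fixes g :: "'p \<Rightarrow> 'y \<Rightarrow> real"
  assumes "prob_space P" "sigma_finite_measure M"
    and g[measurable]: "case_prod g \<in> borel_measurable (P \<Otimes>\<^sub>M M)" and C[measurable]: "C \<in> sets M"
    and nonneg: "\<And>p y. p \<in> space P \<Longrightarrow> y \<in> space M \<Longrightarrow> 0 \<le> g p y"
    and total: "\<And>p. p \<in> space P \<Longrightarrow> (\<integral>\<^sup>+y. ennreal (g p y) \<partial>M) = 1"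
  shows "ennreal (LINT p|P. (LINT y:C|M. g p y)) = (\<integral>\<^sup>+y\<in>C. (\<integral>\<^sup>+p. ennreal (g p y) \<partial>P) \<partial>M)"
proof -
  interpret P: prob_space P by fact
  interpret M: sigma_finite_measure M by fact
  interpret pair_sigma_finite P M ..
  have [measurable]: "(\<lambda>p. LINT y:C|M. g p y) \<in> borel_measurable P"
    unfolding set_lebesgue_integral_def by measurable
  have sec: "ennreal (LINT y:C|M. g p y) = (\<integral>\<^sup>+y\<in>C. ennreal (g p y) \<partial>M)" "(LINT y:C|M. g p y) \<in> {0..1}"
    if "p \<in> space P" for p
    using set_integral_density[of "g p" M C] measurable_Pair2[OF g that] C nonneg[OF that] total[OF that]
    by auto
  have "ennreal (LINT p|P. (LINT y:C|M. g p y)) = (\<integral>\<^sup>+p. ennreal (LINT y:C|M. g p y) \<partial>P)"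
  proof (rule nn_integral_eq_integral[symmetric])
    show "integrable P (\<lambda>p. LINT y:C|M. g p y)"
      by (rule P.integrable_const_bound[where B = 1]) (use sec(2) in \<open>auto intro!: AE_I2\<close>)
    show "AE p in P. 0 \<le> (LINT y:C|M. g p y)"
      using sec(2) by (auto intro!: AE_I2)
  qed
  also have "\<dots> = (\<integral>\<^sup>+p. (\<integral>\<^sup>+y\<in>C. ennreal (g p y) \<partial>M) \<partial>P)"
    by (intro nn_integral_cong sec(1))
  also have "\<dots> = (\<integral>\<^sup>+y. (\<integral>\<^sup>+p. ennreal (g p y) * indicator C y \<partial>P) \<partial>M)"
    by (rule Fubini'[symmetric]) measurable
  also have "\<dots> = (\<integral>\<^sup>+y\<in>C. (\<integral>\<^sup>+p. ennreal (g p y) \<partial>P) \<partial>M)"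
    by (intro nn_integral_cong nn_integral_multc) measurable
  finally show ?thesis .
qed

section \<open>Most powerful regions for a pair of densities\<close>

text \<open>The classical argument integrates the product of 1_A - 1_B and g1 - k g0, but
  differences are unsuitable in \<open>ennreal\<close>. Instead the common part of \<open>A\<close>
  and \<open>B\<close> is split off: trading \<open>B - A\<close> for \<open>A - B\<close> does not
  lower the \<open>g0\<close>-mass, and \<open>g1\<close> is at most \<open>k * g0\<close> on the
  former and at least that on the latter. The two conditions overlap where equality holds, so either
  choice on the boundary is allowed.\<close>

lemma Neyman_Pearson:
  fixes g0 g1 :: "'a \<Rightarrow> ennreal" and k :: ennreal
  assumes [measurable]: "g0 \<in> borel_measurable M" "g1 \<in> borel_measurable M" "A \<in> sets M" "B \<in> sets M"
    and inside: "AE y in M. y \<in> A \<longrightarrow> k * g0 y \<le> g1 y"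
    and outside: "AE y in M. y \<notin> A \<longrightarrow> g1 y \<le> k * g0 y"
    and fin: "(\<integral>\<^sup>+y\<in>A. g0 y \<partial>M) < \<infinity>"
    and size: "(\<integral>\<^sup>+y\<in>B. g0 y \<partial>M) \<le> (\<integral>\<^sup>+y\<in>A. g0 y \<partial>M)"
  shows "(\<integral>\<^sup>+y\<in>B. g1 y \<partial>M) \<le> (\<integral>\<^sup>+y\<in>A. g1 y \<partial>M)"
proof -
  have split: "(\<integral>\<^sup>+y\<in>U. h y \<partial>M) = (\<integral>\<^sup>+y\<in>U \<inter> V. h y \<partial>M) + (\<integral>\<^sup>+y\<in>U - V. h y \<partial>M)"
    if [measurable]: "h \<in> borel_measurable M" "U \<in> sets M" "V \<in> sets M" for h :: "'a \<Rightarrow> ennreal" and U V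
    by (subst nn_integral_add[symmetric]) (auto intro!: nn_integral_cong simp: indicator_def)
  \<comment> \<open>Finiteness permits cancelling the mass of the common part from both sides of
    \<open>size\<close>.\<close>
  have "(\<integral>\<^sup>+y\<in>A \<inter> B. g0 y \<partial>M) < \<infinity>"
    using fin by (rule le_less_trans[rotated]) (auto intro!: nn_integral_mono simp: indicator_def)
  then have diff: "(\<integral>\<^sup>+y\<in>B - A. g0 y \<partial>M) \<le> (\<integral>\<^sup>+y\<in>A - B. g0 y \<partial>M)"
    using size split[of g0 B A] split[of g0 A B]
    by (auto simp: Int_commute[of B A] ennreal_add_left_cancel_le)
  have "(\<integral>\<^sup>+y\<in>B - A. g1 y \<partial>M) \<le> (\<integral>\<^sup>+y. k * (g0 y * indicator (B - A) y) \<partial>M)"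
    using outside by (intro nn_integral_mono_AE) (auto simp: indicator_def)
  also have "\<dots> = k * (\<integral>\<^sup>+y\<in>B - A. g0 y \<partial>M)"
    by (rule nn_integral_cmult) measurable
  also have "\<dots> \<le> k * (\<integral>\<^sup>+y\<in>A - B. g0 y \<partial>M)"
    by (intro mult_left_mono diff) simp
  also have "\<dots> = (\<integral>\<^sup>+y. k * (g0 y * indicator (A - B) y) \<partial>M)"
    by (rule nn_integral_cmult[symmetric]) measurable
  also have "\<dots> \<le> (\<integral>\<^sup>+y\<in>A - B. g1 y \<partial>M)"
    using inside by (intro nn_integral_mono_AE) (auto simp: indicator_def)
  finally show ?thesis
    using split[of g1 B A] split[of g1 A B] by (simp add: Int_commute add_left_mono)
qed

text \<open>For \<open>b = 0\<close> the quotient is 0 or infinite: the first claim is then trivial,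
  and in the second a finite \<open>c\<close> forces \<open>a = 0\<close>. For \<open>b\<close>
  infinite the quotient is 0, and the second claim would fail with \<open>c = 0\<close> and
  \<open>a > 0\<close>.\<close>

lemma divide_compare_ennreal:
  fixes a b c :: ennreal
  assumes "b < \<infinity>" "c < \<infinity>"
  shows "c \<le> a / b \<Longrightarrow> c * b \<le> a" "a / b \<le> c \<Longrightarrow> a \<le> c * b"
proof -
  have cancel: "a / b * b = a" if "b \<noteq> 0"
    using that assms by (simp add: ennreal_divide_times)
  show "c * b \<le> a" if "c \<le> a / b"
    using mult_right_mono[OF that, of b] cancel by (cases "b = 0") auto
  show "a \<le> c * b" if "a / b \<le> c"
    using mult_right_mono[OF that, of b] cancel that assms by (cases "b = 0") (auto split: if_splits simp: top_unique)
qed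

section \<open>A weak law for triangular arrays\<close>

text \<open>The rows live on unrelated probability spaces, so a law of large numbers for a single
  sequence does not apply. Hoeffding's bound for one row depends on that row only through its
  length, which tends to infinity.\<close>

lemma average_tendsto_zero_in_prob:
  fixes X :: "nat \<Rightarrow> 'j \<Rightarrow> 'a \<Rightarrow> real"
  assumes prob: "\<And>n. prob_space (M n)" and fin: "\<And>n. finite (J n)"
    and indep: "\<And>n. prob_space.indep_vars (M n) (\<lambda>_. borel) (X n) (J n)"
    and range: "\<And>n j \<omega>. j \<in> J n \<Longrightarrow> \<omega> \<in> space (M n) \<Longrightarrow> X n j \<omega> \<in> {0..1}"
    and mean: "\<And>n j. j \<in> J n \<Longrightarrow> (LINT \<omega>|M n. X n j \<omega>) = m"
    and card: "filterlim (\<lambda>n. card (J n)) at_top sequentially"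
  shows "tendsto_zero_in_prob M (\<lambda>n \<omega>. (\<Sum>j\<in>J n. X n j \<omega>) / real (card (J n)) - m)"
  unfolding tendsto_zero_in_prob_def
proof (intro conjI allI impI)
  have [measurable]: "X n j \<in> borel_measurable (M n)" if "j \<in> J n" for n j
    using indep[of n] that unfolding prob_space.indep_vars_def[OF prob] by auto
  show [measurable]: "(\<lambda>\<omega>. (\<Sum>j\<in>J n. X n j \<omega>) / real (card (J n)) - m) \<in> borel_measurable (M n)" for n
    by measurable
  fix \<epsilon> :: real assume "\<epsilon> > 0"
  have bound: "measure (M n) {\<omega> \<in> space (M n). \<bar>(\<Sum>j\<in>J n. X n j \<omega>) / real (card (J n)) - m\<bar> > \<epsilon>}
      \<le> 2 * exp (- 2 * \<epsilon>\<^sup>2 * real (card (J n)))" if "card (J n) > 0" for n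
  proof -
    let ?c = "real (card (J n))"
    interpret prob_space "M n" by (rule prob)
    interpret Hoeffding_ineq "M n" "J n" "X n" "\<lambda>_. 0" "\<lambda>_. 1" "\<Sum>j\<in>J n. expectation (X n j)"
      by unfold_locales (use fin indep range in \<open>auto intro!: AE_I2\<close>)
    have "prob {\<omega> \<in> space (M n). \<bar>(\<Sum>j\<in>J n. X n j \<omega>) / ?c - m\<bar> > \<epsilon>}
        \<le> prob {\<omega> \<in> space (M n). \<bar>(\<Sum>j\<in>J n. X n j \<omega>) - (\<Sum>j\<in>J n. expectation (X n j))\<bar> \<ge> ?c * \<epsilon>}"
    proof (intro finite_measure_mono subsetI)
      fix \<omega> assume "\<omega> \<in> {\<omega> \<in> space (M n). \<bar>(\<Sum>j\<in>J n. X n j \<omega>) / ?c - m\<bar> > \<epsilon>}"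
      then have \<omega>: "\<omega> \<in> space (M n)" "\<bar>(\<Sum>j\<in>J n. X n j \<omega>) / ?c - m\<bar> > \<epsilon>" by auto
      \<comment> \<open>All means equal \<open>m\<close>, so a deviation \<epsilon> of the average
        is a deviation \<open>?c * \<epsilon>\<close> of the sum. With ranges of width 1 the
        Hoeffding denominator is \<open>?c\<close>, which cancels one of the two factors
        \<open>?c\<close> in the exponent.\<close>
      have "(\<Sum>j\<in>J n. X n j \<omega>) - (\<Sum>j\<in>J n. expectation (X n j)) = ?c * ((\<Sum>j\<in>J n. X n j \<omega>) / ?c - m)"
        using that by (simp add: mean field_simps)
      then show "\<omega> \<in> {\<omega> \<in> space (M n). \<bar>(\<Sum>j\<in>J n. X n j \<omega>) - (\<Sum>j\<in>J n. expectation (X n j))\<bar> \<ge> ?c * \<epsilon>}"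
        using \<omega> by (simp add: abs_mult mult_left_mono)
    qed measurable
    also have "\<dots> \<le> 2 * exp (- 2 * (?c * \<epsilon>)\<^sup>2 / (\<Sum>j\<in>J n. (1 - 0)\<^sup>2))"
      by (rule Hoeffding_ineq_abs_ge) (use that \<open>\<epsilon> > 0\<close> in auto)
    also have "- 2 * (?c * \<epsilon>)\<^sup>2 / (\<Sum>j\<in>J n. (1 - 0)\<^sup>2) = - 2 * \<epsilon>\<^sup>2 * ?c"
      using that by (simp add: power2_eq_square)
    finally show ?thesis .
  qed
  \<comment> \<open>An empty row has average 0 by the convention for division by zero, and
    \<open>bound\<close> does not cover it; only finitely many rows are empty.\<close>
  have "eventually (\<lambda>n. card (J n) > 0) sequentially"
    by (rule eventually_compose_filterlim[OF eventually_gt_at_top card])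
  then have ev: "\<forall>\<^sub>F n in sequentially.
      measure (M n) {\<omega> \<in> space (M n). \<bar>(\<Sum>j\<in>J n. X n j \<omega>) / real (card (J n)) - m\<bar> > \<epsilon>}
      \<le> 2 * exp (- 2 * \<epsilon>\<^sup>2 * real (card (J n)))"
    by (rule eventually_mono) (rule bound)
  have "((\<lambda>x. 2 * exp (- 2 * \<epsilon>\<^sup>2 * x)) \<longlongrightarrow> 0) at_top"
    using \<open>\<epsilon> > 0\<close> by real_asymp
  moreover have "filterlim (\<lambda>n. real (card (J n))) at_top sequentially"
    using card by (rule filterlim_compose[OF filterlim_real_sequentially])
  ultimately have "(\<lambda>n. 2 * exp (- 2 * \<epsilon>\<^sup>2 * real (card (J n)))) \<longlonglongrightarrow> 0"
    by (rule filterlim_compose)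
  then show "(\<lambda>n. measure (M n) {\<omega> \<in> space (M n). \<bar>(\<Sum>j\<in>J n. X n j \<omega>) / real (card (J n)) - m\<bar> > \<epsilon>})
      \<longlonglongrightarrow> 0"
    by (rule tendsto_sandwich[rotated -1, OF _ _ ev]) auto
qed

section \<open>Rejection probabilities as functions of the parameters\<close>

lemma measurable_Pair_param_space: "Pair \<phi> \<in> measurable sigma_space param_space"
  unfolding param_space_def by measurable

lemma space_param_space: "space param_space = UNIV \<times> {0<..}"
  by (simp add: param_space_def sigma_space_def space_pair_measure space_restrict_space)

lemma rej_prob_in_01:
  assumes f: "density_family f" and C: "C \<in> sets borel" and "\<sigma> > 0"
  shows "rej_prob f \<phi> \<sigma> C \<in> {0..1}"
proof -
  \<comment> \<open>Positivity of \<sigma> places the pair in the space of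
    \<open>param_space\<close>, where joint measurability of \<open>f\<close> is available.\<close>
  have "(\<lambda>y. ((\<phi>, \<sigma>), y)) \<in> measurable borel (param_space \<Otimes>\<^sub>M borel)"
    using \<open>\<sigma> > 0\<close> by (intro measurable_Pair measurable_const) (auto simp: space_param_space)
  from measurable_compose[OF this f[unfolded density_family_def, THEN conjunct1]]
  have "f \<phi> \<sigma> \<in> borel_measurable lborel" by simp
  then show ?thesis
    unfolding rej_prob_def
    by (rule set_integral_density) (use f C \<open>\<sigma> > 0\<close> in \<open>auto simp: density_family_def\<close>)
qed

lemma borel_measurable_rej_prob:
  assumes f: "density_family f" and C[measurable]: "C \<in> sets borel"
  shows "(\<lambda>p. rej_prob f (fst p) (snd p) C) \<in> borel_measurable param_space"
proof -
  have [measurable]: "(\<lambda>(p, y). f (fst p) (snd p) y) \<in> borel_measurable (param_space \<Otimes>\<^sub>M lborel)"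
    using f by (simp add: density_family_def case_prod_unfold cong: measurable_cong_sets)
  show ?thesis
    unfolding rej_prob_def set_lebesgue_integral_def by measurable
qed

lemma prob_space_sigma_marginal:
  assumes "prob_space \<pi>" "sets \<pi> = sets param_space"
  shows "prob_space (sigma_marginal \<pi>)"
proof -
  interpret prob_space \<pi> by fact
  have "snd \<in> measurable \<pi> sigma_space"
    by (simp add: assms(2) param_space_def cong: measurable_cong_sets)
  then show ?thesis
    unfolding sigma_marginal_def by (rule prob_space_distr)
qed

section \<open>BETP and BEFP as probabilities under the mixture densities\<close>

context
  fixes f :: "real \<Rightarrow> real \<Rightarrow> real ^ 't \<Rightarrow> real" and \<pi> :: "(real \<times> real) measure"
  assumes f: "density_family f" and prob: "prob_space \<pi>" and sets_\<pi>: "sets \<pi> = sets param_space"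
begin

lemma space_\<pi>: "space \<pi> = UNIV \<times> {0<..}"
  using sets_eq_imp_space_eq[OF sets_\<pi>] by (simp add: space_param_space)

lemma measurable_density_\<pi>:
  "(\<lambda>(p, y). f (fst p) (snd p) y) \<in> borel_measurable (\<pi> \<Otimes>\<^sub>M lborel)"
proof -
  have "sets (\<pi> \<Otimes>\<^sub>M lborel) = sets (param_space \<Otimes>\<^sub>M (borel :: (real ^ 't) measure))"
    by (intro sets_pair_measure_cong sets_\<pi> sets_lborel)
  then show ?thesis
    using f by (simp add: density_family_def case_prod_unfold cong: measurable_cong_sets)
qed

lemma measurable_density_sigma_marginal:
  "(\<lambda>(\<sigma>, y). f \<phi>\<^sub>0 \<sigma> y) \<in> borel_measurable (sigma_marginal \<pi> \<Otimes>\<^sub>M lborel)"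
proof -
  have sets: "sets (sigma_marginal \<pi> \<Otimes>\<^sub>M lborel) = sets (sigma_space \<Otimes>\<^sub>M (borel :: (real ^ 't) measure))"
    by (intro sets_pair_measure_cong sets_lborel) (simp add: sigma_marginal_def)
  have "(\<lambda>(\<sigma>, y). ((\<phi>\<^sub>0, \<sigma>), y)) \<in>
      measurable (sigma_space \<Otimes>\<^sub>M (borel :: (real ^ 't) measure)) (param_space \<Otimes>\<^sub>M borel)"
    unfolding param_space_def by measurable
  from measurable_compose[OF this f[unfolded density_family_def, THEN conjunct1]]
  show ?thesis
    by (simp add: case_prod_unfold measurable_cong_sets[OF sets refl])
qed

lemma BETP_eq_nn_integral:
  assumes "C \<in> sets borel"
  shows "ennreal (BETP f \<pi> C) = (\<integral>\<^sup>+ y\<in>C. (\<integral>\<^sup>+ (\<phi>, \<sigma>). ennreal (f \<phi> \<sigma> y) \<partial>\<pi>) \<partial>lborel)"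
  using mixture_probability[OF prob sigma_finite_lborel measurable_density_\<pi>, of C] assms f
  by (auto simp: BETP_def rej_prob_def case_prod_unfold space_\<pi> density_family_def)

lemma BEFP_eq_nn_integral:
  assumes "C \<in> sets borel"
  shows "ennreal (BEFP f \<pi> \<phi>\<^sub>0 C) =
    (\<integral>\<^sup>+ y\<in>C. (\<integral>\<^sup>+ \<sigma>. ennreal (f \<phi>\<^sub>0 \<sigma> y) \<partial>sigma_marginal \<pi>) \<partial>lborel)"
proof -
  have "space (sigma_marginal \<pi>) = {0<..}"
    by (simp add: sigma_marginal_def sigma_space_def space_restrict_space)
  then show ?thesis
    using mixture_probability[OF prob_space_sigma_marginal[OF prob sets_\<pi>] sigma_finite_lborel
        measurable_density_sigma_marginal, of C \<phi>\<^sub>0] assms f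
    by (auto simp: BEFP_def rej_prob_def density_family_def)
qed

text \<open>Since \<open>ennreal\<close> truncates negative reals to 0, an inequality between two
  \<open>ennreal\<close> images returns to the reals only when the right-hand side is known to be
  nonnegative.\<close>

lemma BETP_nonneg: "C \<in> sets borel \<Longrightarrow> 0 \<le> BETP f \<pi> C"
  unfolding BETP_def
  by (rule Bochner_Integration.integral_nonneg) (use rej_prob_in_01[OF f] in \<open>auto simp: space_\<pi>\<close>)

section \<open>Convergence of the average true and false positives\<close>

text \<open>The summands are one measurable function with values in [0, 1] applied to independent
  \<open>\<theta> n j\<close> of law \<pi>, so they stay independent and change of variables gives
  each the mean BETP.\<close>

lemma ETP_average_tendsto:
  fixes M :: "nat \<Rightarrow> 'a measure"
  assumes C: "C \<in> sets borel" and problem: "\<And>n. testing_problem \<pi> \<phi>\<^sub>0 (M n) (N n) (F n) (\<theta> n)"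
    and card: "filterlim (\<lambda>n. card (F n)) at_top sequentially"
  shows "tendsto_zero_in_prob M (\<lambda>n \<omega>. ETP f (F n) (\<theta> n) C \<omega> / real (card (F n)) - BETP f \<pi> C)"
  unfolding ETP_def
proof (rule average_tendsto_zero_in_prob)
  let ?r = "\<lambda>p. rej_prob f (fst p) (snd p) C"
  fix n
  note P = problem[of n, unfolded testing_problem_def]
  show "prob_space (M n)" using P by simp
  then interpret prob_space "M n" .
  have F: "F n \<subseteq> {1..N n}" using P by simp
  then show "finite (F n)" by (rule finite_subset) simp
  have "indep_vars (\<lambda>_. param_space) (\<theta> n) (F n)"
    using P F by (blast intro: indep_vars_subset)
  then show "indep_vars (\<lambda>_. borel) (\<lambda>j \<omega>. rej_prob f (fst (\<theta> n j \<omega>)) (snd (\<theta> n j \<omega>)) C) (F n)"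
    by (rule indep_vars_compose2) (rule borel_measurable_rej_prob[OF f C])
  fix j assume j: "j \<in> F n"
  have \<theta>: "\<theta> n j \<in> measurable (M n) param_space"
    using P F j by (auto simp: indep_vars_def)
  show "rej_prob f (fst (\<theta> n j \<omega>)) (snd (\<theta> n j \<omega>)) C \<in> {0..1}" if "\<omega> \<in> space (M n)" for \<omega>
    using measurable_space[OF \<theta> that] by (intro rej_prob_in_01[OF f C]) (auto simp: space_param_space)
  have "BETP f \<pi> C = (LINT p|distr (M n) param_space (\<theta> n j). ?r p)"
    using P j by (simp add: BETP_def case_prod_unfold)
  also have "\<dots> = (LINT \<omega>|M n. ?r (\<theta> n j \<omega>))"
    by (rule integral_distr[OF \<theta> borel_measurable_rej_prob[OF f C]])
  finally show "(LINT \<omega>|M n. rej_prob f (fst (\<theta> n j \<omega>)) (snd (\<theta> n j \<omega>)) C) = BETP f \<pi> C"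
    by simp
qed (rule card)

text \<open>With the first parameter fixed in the definition of EFP, each summand is a function of
  the \<sigma>-component, whose law is the marginal; this makes BEFP the common mean.\<close>

lemma EFP_average_tendsto:
  fixes M :: "nat \<Rightarrow> 'a measure"
  assumes C: "C \<in> sets borel" and problem: "\<And>n. testing_problem \<pi> \<phi>\<^sub>0 (M n) (N n) (F n) (\<theta> n)"
    and card: "filterlim (\<lambda>n. N n - card (F n)) at_top sequentially"
  shows "tendsto_zero_in_prob M
    (\<lambda>n \<omega>. EFP f \<phi>\<^sub>0 (N n) (F n) (\<theta> n) C \<omega> / real (N n - card (F n)) - BEFP f \<pi> \<phi>\<^sub>0 C)"
proof -
  let ?r = "\<lambda>\<sigma>. rej_prob f \<phi>\<^sub>0 \<sigma> C"
  have r: "?r \<in> borel_measurable sigma_space"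
    using measurable_compose[OF measurable_Pair_param_space borel_measurable_rej_prob[OF f C]] by simp
  \<comment> \<open>As \<open>F n\<close> lies in \<open>{1..N n}\<close>, the subtraction of
    naturals is not truncated and counts the true hypotheses.\<close>
  have card_true: "N n - card (F n) = card ({1..N n} - F n)" for n
  proof -
    have "F n \<subseteq> {1..N n}"
      using problem[of n] unfolding testing_problem_def by blast
    then have "card ({1..N n} - F n) = card {1..N n} - card (F n)"
      by (intro card_Diff_subset finite_subset[of "F n" "{1..N n}"]) auto
    then show ?thesis by simp
  qed
  show ?thesis
    unfolding EFP_def card_true
  proof (rule average_tendsto_zero_in_prob)
    fix n
    note P = problem[of n, unfolded testing_problem_def]
    show "prob_space (M n)" using P by simp
    then interpret prob_space "M n" .
    have "indep_vars (\<lambda>_. param_space) (\<theta> n) ({1..N n} - F n)"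
      using P by (blast intro: indep_vars_subset)
    then show "indep_vars (\<lambda>_. borel) (\<lambda>j \<omega>. ?r (snd (\<theta> n j \<omega>))) ({1..N n} - F n)"
    proof (rule indep_vars_compose2)
      have "snd \<in> measurable param_space sigma_space"
        unfolding param_space_def by measurable
      then show "(\<lambda>p. ?r (snd p)) \<in> borel_measurable param_space"
        by (rule measurable_compose[OF _ r])
    qed
    fix j assume j: "j \<in> {1..N n} - F n"
    have \<theta>: "\<theta> n j \<in> measurable (M n) param_space"
      using P j by (auto simp: indep_vars_def)
    then have snd_\<theta>: "(\<lambda>\<omega>. snd (\<theta> n j \<omega>)) \<in> measurable (M n) sigma_space"
      unfolding param_space_def by measurable
    show "?r (snd (\<theta> n j \<omega>)) \<in> {0..1}" if "\<omega> \<in> space (M n)" for \<omega>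
      using measurable_space[OF \<theta> that] by (intro rej_prob_in_01[OF f C]) (auto simp: space_param_space)
    have "BEFP f \<pi> \<phi>\<^sub>0 C = (LINT \<sigma>|distr (M n) sigma_space (\<lambda>\<omega>. snd (\<theta> n j \<omega>)). ?r \<sigma>)"
      using P j by (simp add: BEFP_def)
    also have "\<dots> = (LINT \<omega>|M n. ?r (snd (\<theta> n j \<omega>)))"
      by (rule integral_distr[OF snd_\<theta> r])
    finally show "(LINT \<omega>|M n. ?r (snd (\<theta> n j \<omega>))) = BEFP f \<pi> \<phi>\<^sub>0 C"
      by simp
  qed (use card card_true in simp_all)
qed

section \<open>Optimality of the likelihood-ratio region\<close>

text \<open>The level is the region's own size, so the competitors are exactly the regions of no
  larger size. For a nonnegative threshold, \<open>Neyman_Pearson\<close> applies with the two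
  mixture densities and \<open>k = ennreal crit\<close>.\<close>

lemma MAP_region_C_star:
  assumes D: "emeasure \<pi> (D \<times> {0<..}) = 1"
  shows "MAP_region f \<pi> \<phi>\<^sub>0 (BEFP f \<pi> \<phi>\<^sub>0 (C_star f D \<pi> \<phi>\<^sub>0 crit)) (C_star f D \<pi> \<phi>\<^sub>0 crit)"
proof -
  interpret prob_space \<pi> by (rule prob)
  interpret S: prob_space "sigma_marginal \<pi>" by (rule prob_space_sigma_marginal[OF prob sets_\<pi>])
  define g1 where "g1 y = (\<integral>\<^sup>+ (\<phi>, \<sigma>). ennreal (f \<phi> \<sigma> y) \<partial>\<pi>)" for y
  define g0 where "g0 y = (\<integral>\<^sup>+ \<sigma>. ennreal (f \<phi>\<^sub>0 \<sigma> y) \<partial>sigma_marginal \<pi>)" for y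
  let ?A = "C_star f D \<pi> \<phi>\<^sub>0 crit"
  have [measurable]: "g1 \<in> borel_measurable borel"
  proof -
    have [measurable]: "(\<lambda>(y, p). f (fst p) (snd p) y) \<in> borel_measurable (lborel \<Otimes>\<^sub>M \<pi>)"
      using measurable_pair_swap[OF measurable_density_\<pi>] by (simp add: case_prod_unfold)
    have "g1 \<in> borel_measurable lborel"
      unfolding g1_def case_prod_unfold by measurable
    then show ?thesis by simp
  qed
  have [measurable]: "g0 \<in> borel_measurable borel"
  proof -
    have [measurable]: "(\<lambda>(y, \<sigma>). f \<phi>\<^sub>0 \<sigma> y) \<in> borel_measurable (lborel \<Otimes>\<^sub>M sigma_marginal \<pi>)"
      using measurable_pair_swap[OF measurable_density_sigma_marginal] by (simp add: case_prod_unfold)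
    have "g0 \<in> borel_measurable lborel"
      unfolding g0_def by measurable
    then show ?thesis by simp
  qed
  \<comment> \<open>\<open>emeasure\<close> is 0 off the \<sigma>-algebra, so the value 1 already
    makes this set measurable, whatever \<open>D\<close> is.\<close>
  have "D \<times> {0<..} \<in> sets \<pi>"
    using D emeasure_notin_sets by force
  then have "AE p in \<pi>. p \<in> D \<times> {0<..}"
    using D by (intro AE_prob_1) (simp add: measure_def)
  \<comment> \<open>The numerator's restriction to \<open>D\<close> removes only a \<pi>-null set,
    so it equals the full mixture density \<open>g1\<close>.\<close>
  then have ratio: "lik_ratio f D \<pi> \<phi>\<^sub>0 y = g1 y / g0 y" for y
    unfolding lik_ratio_def g0_def g1_def
    by (intro arg_cong2[where f = divide] refl nn_integral_cong_AE) (auto simp: indicator_def)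
  have A[measurable]: "?A \<in> sets borel"
    unfolding C_star_def ratio by measurable
  have "BETP f \<pi> B \<le> BETP f \<pi> ?A"
    if B[measurable]: "B \<in> sets borel" and size: "BEFP f \<pi> \<phi>\<^sub>0 B \<le> BEFP f \<pi> \<phi>\<^sub>0 ?A" for B
  proof -
    have "(\<integral>\<^sup>+y\<in>B. g1 y \<partial>lborel) \<le> (\<integral>\<^sup>+y\<in>?A. g1 y \<partial>lborel)"
    \<comment> \<open>A negative threshold would become 0 under \<open>ennreal\<close> and describe
      a different region. The ratio always exceeds it, so the region is the whole space and has
      maximal power by monotonicity.\<close>
    proof (cases "crit < 0")
      case True
      then have "ereal crit < enn2ereal r" for r
        by (intro less_le_trans[OF _ enn2ereal_nonneg]) simp
      then have "?A = UNIV"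
        by (simp add: C_star_def)
      then show ?thesis
        by (auto intro!: nn_integral_mono simp: indicator_def)
    next
      case False
      then have mem: "y \<in> ?A \<longleftrightarrow> ennreal crit < g1 y / g0 y" for y
        by (simp add: C_star_def ratio less_ennreal.rep_eq)
      \<comment> \<open>Where \<open>g0 y = \<infinity>\<close> the \<open>ennreal\<close> quotient is \<open>0\<close>, so membership in the region says nothing there.\<close>
      have "(\<integral>\<^sup>+y. g0 y \<partial>lborel) \<noteq> \<infinity>"
        using BEFP_eq_nn_integral[of UNIV \<phi>\<^sub>0, folded g0_def]
          ennreal_neq_top[of "BEFP f \<pi> \<phi>\<^sub>0 UNIV"] by simp
      then have fin: "AE y in lborel. g0 y < \<infinity>"
        using nn_integral_PInf_AE[of g0 lborel] by (simp add: less_top)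
      show ?thesis
      proof (rule Neyman_Pearson)
        show "AE y in lborel. y \<in> ?A \<longrightarrow> ennreal crit * g0 y \<le> g1 y"
          using fin by eventually_elim (auto simp: mem intro: divide_compare_ennreal)
        show "AE y in lborel. y \<notin> ?A \<longrightarrow> g1 y \<le> ennreal crit * g0 y"
          using fin by eventually_elim (auto simp: mem not_less intro: divide_compare_ennreal)
        show "(\<integral>\<^sup>+y\<in>?A. g0 y \<partial>lborel) < \<infinity>"
          using BEFP_eq_nn_integral[OF A, of \<phi>\<^sub>0, folded g0_def] by (metis ennreal_less_top infinity_ennreal_def)
        show "(\<integral>\<^sup>+y\<in>B. g0 y \<partial>lborel) \<le> (\<integral>\<^sup>+y\<in>?A. g0 y \<partial>lborel)"
          using ennreal_leI[OF size]
          unfolding BEFP_eq_nn_integral[OF A] BEFP_eq_nn_integral[OF B] g0_def .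
      qed measurable
    qed
    then have "ennreal (BETP f \<pi> B) \<le> ennreal (BETP f \<pi> ?A)"
      unfolding BETP_eq_nn_integral[OF A] BETP_eq_nn_integral[OF B] g1_def .
    then show ?thesis
      using BETP_nonneg[OF A] by simp
  qed
  then show ?thesis
    using A by (simp add: MAP_region_def)
qed

end

theorem theorem5:
  fixes f :: "real \<Rightarrow> real \<Rightarrow> real ^ 't \<Rightarrow> real"
    and D :: "real set" and \<phi>\<^sub>0 :: real and \<pi> :: "(real \<times> real) measure"
  assumes "density_family f"
    and "\<phi>\<^sub>0 \<notin> D"
    and "prob_space \<pi>" and "sets \<pi> = sets param_space"
    and "emeasure \<pi> (D \<times> {0<..}) = 1"
  shows
    "(\<forall>C \<in> sets borel.
        ennreal (BETP f \<pi> C) = (\<integral>\<^sup>+ y\<in>C. (\<integral>\<^sup>+ (\<phi>, \<sigma>). ennreal (f \<phi> \<sigma> y) \<partial>\<pi>) \<partial>lborel) \<and>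
        ennreal (BEFP f \<pi> \<phi>\<^sub>0 C) =
          (\<integral>\<^sup>+ y\<in>C. (\<integral>\<^sup>+ \<sigma>. ennreal (f \<phi>\<^sub>0 \<sigma> y) \<partial>sigma_marginal \<pi>) \<partial>lborel)) \<and>
     (\<forall>C \<in> sets borel. \<forall>(M :: nat \<Rightarrow> 'a measure) (N :: nat \<Rightarrow> nat) (F :: nat \<Rightarrow> nat set) \<theta>.
        (\<forall>n. testing_problem \<pi> \<phi>\<^sub>0 (M n) (N n) (F n) (\<theta> n)) \<longrightarrow>
        filterlim (\<lambda>n. card (F n)) at_top sequentially \<longrightarrow>
        filterlim (\<lambda>n. N n - card (F n)) at_top sequentially \<longrightarrow>
        tendsto_zero_in_prob M
          (\<lambda>n \<omega>. ETP f (F n) (\<theta> n) C \<omega> / real (card (F n)) - BETP f \<pi> C) \<and>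
        tendsto_zero_in_prob M
          (\<lambda>n \<omega>. EFP f \<phi>\<^sub>0 (N n) (F n) (\<theta> n) C \<omega> / real (N n - card (F n)) - BEFP f \<pi> \<phi>\<^sub>0 C)) \<and>
     (\<forall>\<alpha> \<in> {0..1}. \<forall>crit :: real.
        BEFP f \<pi> \<phi>\<^sub>0 (C_star f D \<pi> \<phi>\<^sub>0 crit) = \<alpha> \<longrightarrow>
        MAP_region f \<pi> \<phi>\<^sub>0 \<alpha> (C_star f D \<pi> \<phi>\<^sub>0 crit))"
  by (intro conjI ballI allI impI BETP_eq_nn_integral[OF assms(1,3,4)] BEFP_eq_nn_integral[OF assms(1,3,4)]
      ETP_average_tendsto[OF assms(1,3,4)] EFP_average_tendsto[OF assms(1,3,4)])
     (use MAP_region_C_star[OF assms(1,3,4,5)] in auto)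

end
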